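(* Let $n,k,p$ be non-negative integers with $p(k^2-1) \le n$, and let $\mathscr{F}$ be a family of $t$ graphs, each with $n$ vertices, $k$-colorable, and of pathwidth at most $p$. If $t \ge \max\{4k^2, 811\}$, then \[ \mathscr{U}(\mathscr{F}) ~<~ \frac{15}{7}\sqrt{t}\, n . \]
   Context: A graph $U$ is an induced-universal graph for a family $\mathscr{F}$ if every graph of $\mathscr{F}$ is isomorphic to an induced subgraph of $U$; $\mathscr{U}(\mathscr{F})$ is the smallest number of vertices of such a $U$. *)

theory Defs
  imports Complex_Main
begin

type_synonym graph = "nat set \<times> (nat \<times> nat) set"

definition verts :: "graph \<Rightarrow> nat set" where "verts G = fst G"
definition edges :: "graph \<Rightarrow> (nat \<times> nat) set" where "edges G = snd G"

definition simple_graph :: "graph \<Rightarrow> bool" where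
  "simple_graph G \<longleftrightarrow> finite (verts G) \<and> edges G \<subseteq> verts G \<times> verts G
     \<and> (\<forall>u v. (u, v) \<in> edges G \<longrightarrow> (v, u) \<in> edges G)
     \<and> (\<forall>v. (v, v) \<notin> edges G)"

definition induced_embeds :: "graph \<Rightarrow> graph \<Rightarrow> bool" where
  "induced_embeds G U \<longleftrightarrow> (\<exists>f. inj_on f (verts G) \<and> f ` verts G \<subseteq> verts U
     \<and> (\<forall>u\<in>verts G. \<forall>v\<in>verts G. (u, v) \<in> edges G \<longleftrightarrow> (f u, f v) \<in> edges U))"

definition induced_universal :: "graph \<Rightarrow> graph set \<Rightarrow> bool" where
  "induced_universal U F \<longleftrightarrow> simple_graph U \<and> (\<forall>G\<in>F. induced_embeds G U)"

definition univ_num :: "graph set \<Rightarrow> nat" where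
  "univ_num F = (LEAST m. \<exists>U. induced_universal U F \<and> card (verts U) = m)"

definition colorable :: "nat \<Rightarrow> graph \<Rightarrow> bool" where
  "colorable k G \<longleftrightarrow> (\<exists>c :: nat \<Rightarrow> nat. c ` verts G \<subseteq> {0..<k}
     \<and> (\<forall>(u, v)\<in>edges G. c u \<noteq> c v))"

definition path_decomposition :: "graph \<Rightarrow> nat set list \<Rightarrow> bool" where
  "path_decomposition G Bs \<longleftrightarrow>
     (\<forall>i<length Bs. Bs ! i \<subseteq> verts G)
     \<and> (\<forall>v\<in>verts G. \<exists>i<length Bs. v \<in> Bs ! i)
     \<and> (\<forall>(u, v)\<in>edges G. \<exists>i<length Bs. u \<in> Bs ! i \<and> v \<in> Bs ! i)
     \<and> (\<forall>v i j l. i \<le> j \<and> j \<le> l \<and> l < length Bs \<and> v \<in> Bs ! i \<and> v \<in> Bs ! l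
          \<longrightarrow> v \<in> Bs ! j)"

definition pathwidth_le :: "nat \<Rightarrow> graph \<Rightarrow> bool" where
  "pathwidth_le p G \<longleftrightarrow> (\<exists>Bs. path_decomposition G Bs
     \<and> (\<forall>i<length Bs. card (Bs ! i) \<le> p + 1))"

end

(*
  The graph with index l in the family is assigned the line i |-> a * i + b over the field with m
  elements, where (a, b) are the base-m digits of l; for m^2 >= t distinct graphs get distinct
  lines, and these agree in at most one point. Cut every graph into at most m independent pieces
  of at most s vertices and send piece number i to the cell (i, a * i + b) of a grid whose cells
  hold s vertices each. Two graphs share at most one cell, and no cell carries an edge, so each
  graph is induced in the union. Since k <= sqrt t / 2, this uses fewer than (15/7) sqrt t * n
  vertices as soon as sqrt t <= m <= (4/3) sqrt t. A prime m in this range exists by Chebyshev's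
  method, with the factorial ratio N! (N/30)! / ((N/2)! (N/3)! (N/5)!), for large t,
  and by a chain of explicit primes for small t.
*)
theory Submission
  imports Defs "HOL-Number_Theory.Prime_Powers"
begin

section \<open>Primes between n and 4n/3\<close>

definition psi :: "nat \<Rightarrow> real" where
  "psi N = (\<Sum>d = 1..N. mangoldt d)"

definition lnfact :: "nat \<Rightarrow> real" where
  "lnfact N = ln (fact N)"

definition cheb :: "nat \<Rightarrow> real" where
  "cheb N = lnfact N - lnfact (N div 2) - lnfact (N div 3) - lnfact (N div 5) + lnfact (N div 30)"

text \<open>Chebyshev's constant, about 0.921: the growth rate of \<open>cheb N\<close> per unit of
  \<open>N\<close>.\<close>

definition cheb_const :: real where
  "cheb_const = ln 2 / 2 + ln 3 / 3 + ln 5 / 5 - ln 30 / 30"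

text \<open>Passing from \<open>N\<close> to \<open>Suc N\<close> raises \<open>N div d\<close> by 1
  exactly when \<open>d\<close> divides \<open>Suc N\<close>, and the von Mangoldt values over the
  divisors of \<open>Suc N\<close> sum to its logarithm. Terms with \<open>d > N\<close> vanish; the
  free upper limit \<open>K\<close> lets all five factorials in \<open>cheb\<close> share one range
  of summation.\<close>

lemma lnfact_eq_sum_mangoldt:
  assumes "N \<le> K"
  shows "lnfact N = (\<Sum>d = 1..K. mangoldt d * real (N div d))"
  using assms
proof (induction N)
  case 0
  then show ?case by (simp add: lnfact_def)
next
  case (Suc N)
  have "lnfact (Suc N) = ln (real (Suc N)) + lnfact N"
    by (simp add: lnfact_def ln_mult del: of_nat_Suc)
  also have "ln (real (Suc N)) = (\<Sum>d | d dvd Suc N. mangoldt d)"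
    using mangoldt_sum[of "Suc N", where 'a = real] by simp
  also have "\<dots> = (\<Sum>d = 1..K. mangoldt d * of_bool (d dvd Suc N))"
  proof (rule sum.mono_neutral_cong_left)
    show "{d. d dvd Suc N} \<subseteq> {1..K}"
    proof
      fix d assume "d \<in> {d. d dvd Suc N}"
      then have "d dvd Suc N" by simp
      then have "d \<le> Suc N" "d \<noteq> 0"
        by (auto dest: dvd_imp_le intro!: Nat.gr0I)
      with Suc.prems show "d \<in> {1..K}" by auto
    qed
  qed auto
  also have "lnfact N = (\<Sum>d = 1..K. mangoldt d * real (N div d))"
    using Suc by simp
  also have "(\<Sum>d = 1..K. mangoldt d * of_bool (d dvd Suc N)) + \<dots>
      = (\<Sum>d = 1..K. mangoldt d * real (Suc N div d))"
    unfolding sum.distrib[symmetric]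
    by (intro sum.cong refl) (auto simp: div_Suc dvd_eq_mod_eq_0 algebra_simps)
  finally show ?case .
qed

definition cheb_coeff :: "nat \<Rightarrow> real" where
  "cheb_coeff y = real y - real (y div 2) - real (y div 3) - real (y div 5) + real (y div 30)"

lemma cheb_eq_sum_mangoldt: "cheb N = (\<Sum>d = 1..N. mangoldt d * cheb_coeff (N div d))"
proof -
  have "lnfact (N div k) = (\<Sum>d = 1..N. mangoldt d * real (N div d div k))" for k
    by (subst lnfact_eq_sum_mangoldt[of _ N])
      (simp_all add: div_mult2_eq[symmetric] mult.commute)
  then show ?thesis
    unfolding cheb_def cheb_coeff_def lnfact_eq_sum_mangoldt[of N N, simplified]
    by (simp add: algebra_simps sum.distrib sum_subtractf)
qed

text \<open>The function has period 30, since $1 - 1/2 - 1/3 - 1/5 + 1/30 = 0$.\<close>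
lemma cheb_coeff_bounds: "0 \<le> cheb_coeff y" "cheb_coeff y \<le> 1"
proof -
  have "y div 2 + y div 3 + y div 5 \<le> y + y div 30 \<and>
      y + y div 30 \<le> y div 2 + y div 3 + y div 5 + 1"
  proof -
    define q r where "q = y div 30" and "r = y mod 30"
    have y: "y = 30 * q + r" and "r < 30" by (simp_all add: q_def r_def)
    have "y div 2 = 15 * q + r div 2" "y div 3 = 10 * q + r div 3" "y div 5 = 6 * q + r div 5"
      "y div 30 = q"
      using y \<open>r < 30\<close> by simp_all
    moreover have "\<forall>r\<in>{..<30::nat}. r div 2 + r div 3 + r div 5 \<le> r \<and>
        r \<le> r div 2 + r div 3 + r div 5 + 1"
      by (simp add: lessThan_nat_numeral lessThan_Suc)
    ultimately show ?thesis using y \<open>r < 30\<close> by (auto simp: Ball_def)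
  qed
  then have "real (y div 2 + y div 3 + y div 5) \<le> real (y + y div 30)"
    "real (y + y div 30) \<le> real (y div 2 + y div 3 + y div 5 + 1)"
    by (simp_all only: of_nat_le_iff)
  then show "0 \<le> cheb_coeff y" "cheb_coeff y \<le> 1"
    by (simp_all add: cheb_coeff_def)
qed

lemma cheb_coeff_eq_1:
  assumes "0 < y" "y < 6"
  shows "cheb_coeff y = 1"
proof -
  have "y \<in> {1, 2, 3, 4, 5}" using assms by auto
  then show ?thesis by (auto simp: cheb_coeff_def)
qed

lemma cheb_le_psi: "cheb N \<le> psi N"
  unfolding cheb_eq_sum_mangoldt psi_def
  by (intro sum_mono) (use cheb_coeff_bounds mangoldt_nonneg in \<open>auto intro: mult_left_le\<close>)

text \<open>For \<open>d\<close> beyond \<open>N div 6\<close> the quotient \<open>N div d\<close>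
  is between 1 and 5, where the coefficient is exactly 1 (it first drops to 0 at 6). The other terms
  are nonnegative and may be discarded.\<close>

lemma psi_diff_le_cheb: "psi N - psi (N div 6) \<le> cheb N"
proof -
  have "{1..N} = {1..N div 6} \<union> {N div 6<..N}" by auto
  then have "psi N = psi (N div 6) + (\<Sum>d\<in>{N div 6<..N}. mangoldt d)"
    unfolding psi_def by (subst sum.union_disjoint[symmetric]) auto
  also have "(\<Sum>d\<in>{N div 6<..N}. mangoldt d)
      = (\<Sum>d\<in>{N div 6<..N}. mangoldt d * cheb_coeff (N div d))"
  proof (intro sum.cong refl)
    fix d assume d: "d \<in> {N div 6<..N}"
    have "N < 6 * d" using d by (auto simp: less_mult_imp_div_less div_less_iff_less_mult mult.commute)
    then have "N div d < 6" by (simp add: less_mult_imp_div_less)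
    moreover have "0 < N div d" using d by (auto simp: div_greater_zero_iff)
    ultimately show "mangoldt d = mangoldt d * cheb_coeff (N div d)"
      by (simp add: cheb_coeff_eq_1)
  qed
  also have "\<dots> \<le> cheb N"
    unfolding cheb_eq_sum_mangoldt
    by (intro sum_mono2) (auto intro!: mult_nonneg_nonneg mangoldt_nonneg cheb_coeff_bounds)
  finally show ?thesis by simp
qed

section \<open>Approximating logarithms of factorials by the integral of the logarithm\<close>

text \<open>The integral of \<open>ln\<close> from 1 to \<open>y\<close>.\<close>
definition xlnx :: "real \<Rightarrow> real" where
  "xlnx y = y * ln y - y + 1"

text \<open>Convexity: the graph of \<open>xlnx\<close> lies above its tangent at \<open>b\<close>,
  whose slope is \<open>ln b\<close>. Since \<open>a\<close> and \<open>b\<close> are not ordered,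
  the lemma bounds increments from both sides.\<close>

lemma xlnx_diff:
  assumes "0 < a" "0 < b"
  shows "xlnx b - xlnx a \<le> (b - a) * ln b"
proof -
  have "ln (b / a) \<le> b / a - 1" using assms by (intro ln_le_minus_one) simp
  then have "a * ln (b / a) \<le> a * (b / a - 1)" using assms by (intro mult_left_mono) auto
  then show ?thesis using assms
    by (simp add: xlnx_def ln_div algebra_simps)
qed

lemma lnfact_bounds:
  assumes "0 < m"
  shows "xlnx (real m) \<le> lnfact m \<and> lnfact m \<le> xlnx (real m) + ln (real m)"
  using assms
proof (induction m rule: nat_induct_non_zero)
  case 1
  then show ?case by (simp add: xlnx_def lnfact_def)
next
  case (Suc m)
  have "lnfact (Suc m) = ln (real (Suc m)) + lnfact m"
    by (simp add: lnfact_def ln_mult del: of_nat_Suc)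
  moreover have "xlnx (real (Suc m)) - xlnx (real m) \<le> ln (real (Suc m))"
    using xlnx_diff[of "real m" "real (Suc m)"] Suc by simp
  moreover have "xlnx (real m) - xlnx (real (Suc m)) \<le> - ln (real m)"
    using xlnx_diff[of "real (Suc m)" "real m"] Suc by simp
  ultimately show ?case using Suc.IH by linarith
qed

text \<open>Rounding \<open>N / d\<close> down moves the argument of \<open>xlnx\<close> by less
  than 1, hence its value by at most the logarithm. The summand 1 covers \<open>d > N\<close>, where
  the factorial is 1 and \<open>xlnx\<close> takes values in [0, 1].\<close>

lemma lnfact_div_error:
  assumes "0 < N" "0 < d"
  shows "\<bar>lnfact (N div d) - xlnx (real N / real d)\<bar> \<le> 1 + ln (real N)"
proof (cases "d \<le> N")
  case True
  define m where "m = N div d"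
  define y where "y = real N / real d"
  have "real (m * d) \<le> real N" "real N < real (d + d * m)"
    unfolding m_def of_nat_le_iff of_nat_less_iff
    using assms by (auto intro: dividend_less_times_div)
  then have m: "0 < m" "real m \<le> y" "y < real m + 1"
    using True assms by (auto simp: m_def y_def div_greater_zero_iff field_simps)
  have "y \<le> real N" using assms by (simp add: y_def divide_le_eq mult_le_cancel_left1)
  have y1: "1 \<le> y" using m by linarith
  have lny: "ln y \<le> ln (real N)" "0 \<le> ln y" using \<open>y \<le> real N\<close> y1 by simp_all
  have lnm: "ln (real m) \<le> ln y" "0 \<le> ln (real m)" using m by simp_all
  have "xlnx y - xlnx (real m) \<le> (y - real m) * ln y"
    using m y1 by (intro xlnx_diff) auto
  also have "\<dots> \<le> ln y" using m lny by (intro mult_left_le_one_le) auto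
  finally have 1: "xlnx y - xlnx (real m) \<le> ln y" .
  have "xlnx (real m) - xlnx y \<le> (real m - y) * ln (real m)"
    using m y1 by (intro xlnx_diff) auto
  also have "\<dots> \<le> 0" using m lnm by (intro mult_nonpos_nonneg) auto
  finally have "xlnx (real m) \<le> xlnx y" by simp
  with 1 lnfact_bounds[OF m(1)] lny lnm show ?thesis
    unfolding m_def[symmetric] y_def[symmetric] by (simp add: abs_le_iff)
next
  case False
  define y where "y = real N / real d"
  have y: "0 < y" "y < 1" using False assms by (auto simp: y_def)
  have "xlnx 1 - xlnx y \<le> (1 - y) * ln 1" using y by (intro xlnx_diff) auto
  then have "0 \<le> xlnx y" by (simp add: xlnx_def)
  moreover have "y * ln y \<le> 0" using y by (intro mult_nonneg_nonpos) auto
  then have "xlnx y \<le> 1" using y unfolding xlnx_def by linarith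
  moreover have "lnfact (N div d) = 0" using False by (simp add: lnfact_def)
  moreover have "0 \<le> ln (real N)" using assms by simp
  ultimately show ?thesis unfolding y_def[symmetric] by simp
qed

lemma cheb_estimate:
  assumes "0 < N"
  shows "\<bar>cheb N - (cheb_const * real N - 1)\<bar> \<le> 5 * (1 + ln (real N))"
proof -
  let ?h = "\<lambda>d. xlnx (real N / real d)"
  have xl: "?h d = real N / d * (ln N - ln d) - real N / d + 1" if "0 < d" for d :: nat
    using assms that by (simp add: xlnx_def ln_div)
  \<comment> \<open>Since 1 - 1/2 - 1/3 - 1/5 + 1/30 = 0, the terms of order N ln N and the terms
    -N/d cancel. The constants 1 in \<open>xlnx\<close> leave 1 - 3 + 1 = -1.\<close>
  have "?h 1 - ?h 2 - ?h 3 - ?h 5 + ?h 30 = cheb_const * real N - 1"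
    unfolding xl[of 1, simplified] xl[of 2, simplified] xl[of 3, simplified]
      xl[of 5, simplified] xl[of 30, simplified]
    using xl[of 1] xl[of 2] xl[of 3] xl[of 5] xl[of 30]
    by (simp add: cheb_const_def field_simps)
  moreover note lnfact_div_error[OF assms, of 1] lnfact_div_error[OF assms, of 2]
    lnfact_div_error[OF assms, of 3] lnfact_div_error[OF assms, of 5]
    lnfact_div_error[OF assms, of 30]
  ultimately show ?thesis
    unfolding cheb_def by (simp add: abs_le_iff)
qed

section \<open>Numerical bounds for logarithms and the upper bound for \<open>psi\<close>\<close>

text \<open>As e is at most 3, a comparison of integer powers yields a rational lower bound for a
  logarithm.\<close>

lemma ln_ge_ratio:
  assumes "0 < x" "0 < q" "3 ^ p \<le> x ^ q"
  shows "real p / real q \<le> ln (x::real)"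
proof -
  have "exp (real p) = exp 1 ^ p" by (simp add: exp_of_nat_mult[symmetric])
  also have "\<dots> \<le> 3 ^ p" using exp_le by (intro power_mono) auto
  also have "\<dots> \<le> x ^ q" by fact
  finally have "real p \<le> ln (x ^ q)" using assms by (subst ln_ge_iff) auto
  then show ?thesis using assms by (simp add: ln_realpow field_simps)
qed

lemma cheb_const_ge: "8 / 10 \<le> cheb_const"
proof -
  \<comment> \<open>After this split the coefficients of ln 2, ln 3, ln 5 are 7/15, 3/10, 1/6. All
    are positive, so lower bounds for the three logarithms suffice.\<close>
  have "ln (30::real) = ln 2 + ln 3 + ln 5"
    using ln_mult[of "2::real" 3] ln_mult[of "6::real" 5] by simp
  moreover have "3 / 5 \<le> ln (2::real)" using ln_ge_ratio[of 2 5 3] by simp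
  moreover have "1 \<le> ln (3::real)" using ln_ge_ratio[of 3 1 1] by simp
  moreover have "4 / 3 \<le> ln (5::real)" using ln_ge_ratio[of 5 3 4] by simp
  ultimately show ?thesis unfolding cheb_const_def by linarith
qed

text \<open>Iterating \<open>psi_diff_le_cheb\<close> along N, N/6, N/36, ... sums a geometric
  series, whence the factor 6/5. The squared logarithm absorbs the errors of the logarithmically
  many rounds.\<close>

lemma psi_le:
  assumes "0 < N"
  shows "psi N \<le> 6 / 5 * cheb_const * real N + 32 / 10 * (ln (real N))\<^sup>2 + 5 * ln (real N) + 4"
  using assms
proof (induction N rule: less_induct)
  case (less N)
  let ?L = "ln (real N)"
  have L: "0 \<le> ?L" using less.prems by simp
  have "psi N \<le> psi (N div 6) + cheb N" using psi_diff_le_cheb[of N] by simp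
  also have "cheb N \<le> cheb_const * real N + 4 + 5 * ?L"
    using cheb_estimate[OF less.prems] by (simp add: abs_le_iff)
  finally have step: "psi N \<le> psi (N div 6) + (cheb_const * real N + 4 + 5 * ?L)" by simp
  show ?case
  proof (cases "N < 6")
    case True
    then have "psi (N div 6) = 0" by (simp add: psi_def)
    moreover have "0 \<le> 1 / 5 * (cheb_const * real N)" using cheb_const_ge by simp
    moreover have "0 \<le> 32 / 10 * ?L\<^sup>2" by simp
    ultimately show ?thesis using step by linarith
  next
    case False
    define N' where "N' = N div 6"
    define l where "l = ln (6::real)"
    have l: "16 / 10 \<le> l"
      using ln_mult[of "2::real" 3] ln_ge_ratio[of 2 5 3] ln_ge_ratio[of 3 1 1] by (simp add: l_def)
    have N': "0 < N'" "N' < N" "real N' \<le> real N / 6"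
      using False of_nat_le_iff[of "6 * (N div 6)" N, where 'a = real] by (auto simp: N'_def)
    have "ln (real N') \<le> ln (real N / 6)" using N' by simp
    also have "\<dots> = ?L - l" using less.prems by (simp add: ln_div l_def)
    finally have L': "ln (real N') \<le> ?L - l" "0 \<le> ln (real N')" using N' by simp_all
    \<comment> \<open>Replacing \<open>N\<close> by \<open>N div 6\<close> lowers the square by at
      least 1.6 times the logarithm. As 3.2 * 1.6 > 5, this pays for the new error
      \<open>5 * ?L\<close>, while the drop of the linear term by \<open>5 * l\<close>, at least 8,
      pays for the constant 4.\<close>
    have "(ln (real N'))\<^sup>2 \<le> (?L - l)\<^sup>2" using L' by (intro power_mono) auto
    also have "\<dots> = ?L\<^sup>2 - l * (?L + (?L - l))" by (simp add: power2_eq_square algebra_simps)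
    finally have "(ln (real N'))\<^sup>2 \<le> ?L\<^sup>2 - l * (?L + (?L - l))" .
    moreover have "16 / 10 * ?L \<le> l * (?L + (?L - l))" using l L L' by (intro mult_mono) auto
    ultimately have sq: "(ln (real N'))\<^sup>2 \<le> ?L\<^sup>2 - 16 / 10 * ?L" by linarith
    have "cheb_const * real N' \<le> cheb_const * (real N / 6)"
      using N' cheb_const_ge by (intro mult_left_mono) auto
    with less.IH[OF N'(2,1)] step sq L' l L show ?thesis
      unfolding N'_def[symmetric] by linarith
  qed
qed

section \<open>Primes in (n, 4n/3] for large n\<close>

text \<open>
  Without primes in the interval only proper prime powers contribute, at most one for each base
  since the interval is too short to contain two powers of the same prime.
\<close>
lemma psi_diff_le_sqrt:
  assumes "n \<le> M" "M < 2 * n" and no_prime: "\<And>p. prime p \<Longrightarrow> n < p \<Longrightarrow> \<not> p \<le> M"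
  shows "psi M - psi n \<le> sqrt (real M) * (ln (real M) / 2)"
proof -
  define S where "S = {d \<in> {n<..M}. primepow d}"
  have pp: "\<exists>k\<ge>2. d = aprimedivisor d ^ k \<and> prime (aprimedivisor d) \<and> (aprimedivisor d)\<^sup>2 \<le> M"
    if "d \<in> S" for d
  proof -
    from that obtain p k where p: "prime p" "0 < k" "d = p ^ k" and d: "n < d" "d \<le> M"
      by (auto simp: S_def primepow_def)
    have "k \<noteq> 1" using no_prime p d by auto
    with p have "2 \<le> k" by simp
    moreover have "aprimedivisor d = p" using p by (simp add: aprimedivisor_prime_power)
    moreover have "p\<^sup>2 \<le> p ^ k" using \<open>2 \<le> k\<close> p prime_gt_0_nat by (intro power_increasing) (auto simp: Suc_le_eq)
    ultimately show ?thesis using p d by auto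
  qed
  have inj: "inj_on aprimedivisor S"
  proof (rule inj_onI)
    have *: "\<not> k < l" if "prime p" "n < p ^ k" "p ^ l \<le> M" for p k l :: nat
    proof
      assume "k < l"
      have "2 * p ^ k \<le> p ^ Suc k" using prime_ge_2_nat[OF that(1)] by simp
      also have "\<dots> \<le> p ^ l" using \<open>k < l\<close> prime_gt_0_nat[OF that(1)]
        by (intro power_increasing) auto
      finally show False using that assms by linarith
    qed
    fix d e assume de: "d \<in> S" "e \<in> S" "aprimedivisor d = aprimedivisor e"
    obtain k where k: "d = aprimedivisor d ^ k" "prime (aprimedivisor d)" using pp[OF de(1)] by auto
    obtain l where l: "e = aprimedivisor d ^ l" using pp[OF de(2)] de(3) by auto
    have "n < d" "d \<le> M" "n < e" "e \<le> M" using de by (auto simp: S_def)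
    then have "\<not> k < l" "\<not> l < k" using *[OF k(2), of k l] *[OF k(2), of l k] k(1) l by auto
    then show "d = e" using k(1) l by (metis linorder_neqE_nat)
  qed
  \<comment> \<open>All exponents are at least 2, so the bases are at most sqrt M. By injectivity
    there are at most that many prime powers, each contributing at most half of ln M.\<close>
  have "aprimedivisor ` S \<subseteq> {1..nat \<lfloor>sqrt (real M)\<rfloor>}"
  proof
    fix p assume "p \<in> aprimedivisor ` S"
    then have "prime p" "p\<^sup>2 \<le> M" using pp by auto
    then have "(real p)\<^sup>2 \<le> real M" by (metis of_nat_le_iff of_nat_power)
    then have "real p \<le> sqrt (real M)" by (rule real_le_rsqrt)
    then show "p \<in> {1..nat \<lfloor>sqrt (real M)\<rfloor>}" using prime_gt_0_nat[OF \<open>prime p\<close>]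
      by (auto simp: le_nat_floor Suc_le_eq)
  qed
  then have "card S \<le> card {1..nat \<lfloor>sqrt (real M)\<rfloor>}"
    by (intro card_inj_on_le[OF inj]) auto
  then have card: "real (card S) \<le> sqrt (real M)"
    by (simp add: of_nat_floor le_nat_iff le_floor_iff)
  have "{1..M} = {1..n} \<union> {n<..M}" using assms by auto
  then have "psi M = psi n + (\<Sum>d\<in>{n<..M}. mangoldt d)"
    unfolding psi_def by (subst sum.union_disjoint[symmetric]) auto
  then have "psi M - psi n = (\<Sum>d\<in>{n<..M}. mangoldt d)" by simp
  also have "\<dots> = (\<Sum>d\<in>S. mangoldt d)"
    by (intro sum.mono_neutral_right) (auto simp: S_def mangoldt_def)
  also have "\<dots> \<le> (\<Sum>d\<in>S. ln (real M) / 2)"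
  proof (rule sum_mono)
    fix d assume d: "d \<in> S"
    let ?p = "aprimedivisor d"
    have p: "prime ?p" "?p\<^sup>2 \<le> M" using pp[OF d] by auto
    have "0 < ?p" using p prime_gt_0_nat by blast
    have "(real ?p)\<^sup>2 \<le> real M" using p by (metis of_nat_le_iff of_nat_power)
    then have "ln ((real ?p)\<^sup>2) \<le> ln (real M)" using \<open>0 < ?p\<close> d by (subst ln_le_cancel_iff) (auto simp: S_def)
    then show "mangoldt d \<le> ln (real M) / 2"
      using d \<open>0 < ?p\<close> by (simp add: S_def mangoldt_def ln_realpow)
  qed
  also have "\<dots> = real (card S) * (ln (real M) / 2)" by simp
  also have "\<dots> \<le> sqrt (real M) * (ln (real M) / 2)"
    using card assms by (intro mult_right_mono) auto
  finally show ?thesis .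
qed

text \<open>The interval reaches 4/3, beyond the ratio 6/5 of the upper and lower bounds for
  \<open>psi\<close>, so \<open>psi\<close> grows linearly across it, too much for proper prime
  powers alone. Writing n as the fourth power of \<open>z\<close>, with ln z below a linear
  function, turns this into a quartic exceeding cubic terms once \<open>z\<close> is at least
  12.\<close>

lemma prime_between_large:
  assumes "12 ^ 4 \<le> n"
  shows "\<exists>p. prime p \<and> n < p \<and> 3 * p \<le> 4 * (n::nat)"
proof (rule ccontr)
  assume contra: "\<not> ?thesis"
  define M where "M = 4 * n div 3"
  define z where "z = sqrt (sqrt (real n))"
  define L where "L = ln (real n)"
  have n: "0 < n" "n \<le> M" "M < 2 * n" using assms by (auto simp: M_def)
  have M: "real M \<le> 4 / 3 * real n" "4 / 3 * real n - 2 / 3 \<le> real M"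
    unfolding M_def by linarith+
  have "psi M - psi n \<le> sqrt (real M) * (ln (real M) / 2)"
    using contra n by (intro psi_diff_le_sqrt) (auto simp: M_def)
  moreover have "cheb_const * real M - 1 - 5 * (1 + ln (real M)) \<le> psi M"
    using cheb_le_psi[of M] cheb_estimate[of M] n by (simp add: abs_le_iff)
  moreover have "psi n \<le> 6 / 5 * cheb_const * real n + 32 / 10 * L\<^sup>2 + 5 * L + 4"
    using psi_le[of n] n by (simp add: L_def)
  moreover have "cheb_const * (4 / 3 * real n - 2 / 3) \<le> cheb_const * real M"
    using M cheb_const_ge by (intro mult_left_mono) auto
  \<comment> \<open>Here 2/15 = 4/3 - 6/5, and the 2/3 is the loss from rounding 4n/3 down.\<close>
  moreover have "8 / 10 * (2 / 15 * real n - 2 / 3) \<le> cheb_const * (2 / 15 * real n - 2 / 3)"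
    using assms cheb_const_ge by (intro mult_right_mono) auto
  ultimately have main: "8 / 10 * (2 / 15 * real n - 2 / 3) - 1 - 5 * (1 + ln (real M))
      \<le> 32 / 10 * L\<^sup>2 + 5 * L + 4 + sqrt (real M) * (ln (real M) / 2)"
    by (simp add: algebra_simps)
  have z2: "z\<^sup>2 = sqrt (real n)" and "0 \<le> z" by (simp_all add: z_def)
  have z4: "z ^ 4 = real n"
    using z2 by (metis of_nat_0_le_iff power2_eq_square power4_eq_xxxx real_sqrt_pow2 mult.assoc)
  have "12 \<le> z"
  proof -
    have "(12::real) ^ 4 \<le> z ^ 4" unfolding z4 using assms by (metis of_nat_le_iff of_nat_numeral of_nat_power)
    then show ?thesis using \<open>0 \<le> z\<close> power_mono_iff[of 12 z 4] by simp
  qed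
  \<comment> \<open>The tangent to the logarithm at 15, with ln 15 at most 3 because e is at least
    5/2 and the cube of 5/2 exceeds 15.\<close>
  have "ln z \<le> z / 15 + 2"
  proof -
    have "(5 / 2) ^ 3 \<le> exp (1::real) ^ 3"
      using exp_lower_Taylor_quadratic[of "1::real"] by (intro power_mono) auto
    also have "\<dots> = exp 3" by (simp add: exp_of_nat_mult[symmetric])
    finally have "(15::real) \<le> exp 3" by (simp add: power3_eq_cube)
    then have "ln (15::real) \<le> 3" using ln_le_cancel_iff[of 15 "exp (3::real)"] by simp
    moreover have "ln (z / 15) \<le> z / 15 - 1" using \<open>12 \<le> z\<close> by (intro ln_le_minus_one) auto
    ultimately show ?thesis using \<open>12 \<le> z\<close> by (simp add: ln_div)
  qed
  moreover have "L = 4 * ln z" using \<open>12 \<le> z\<close> by (simp add: L_def z4[symmetric] ln_realpow)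
  ultimately have L: "L \<le> 4 * (z / 15 + 2)" by simp
  have L0: "0 \<le> L" using n by (simp add: L_def)
  have "ln (real M) \<le> ln (4 / 3 * real n)" using M n by (subst ln_le_cancel_iff) linarith+
  also have "\<dots> = ln (4 / 3) + L" using n ln_mult[of "4 / 3" "real n"] by (simp add: L_def)
  also have "ln (4 / 3) \<le> (1 / 3 :: real)" using ln_le_minus_one[of "4 / 3 :: real"] by simp
  finally have lnM: "ln (real M) \<le> 4 * (z / 15 + 2) + 1 / 3" using L by simp
  \<comment> \<open>The square of 1.16 exceeds 4/3.\<close>
  have "sqrt (real M) \<le> 116 / 100 * z\<^sup>2"
  proof (rule real_le_lsqrt)
    have "(116 / 100 * z\<^sup>2)\<^sup>2 = (116 / 100)\<^sup>2 * z ^ 4" 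
      by (simp add: power2_eq_square power4_eq_xxxx)
    with M z4 show "real M \<le> (116 / 100 * z\<^sup>2)\<^sup>2" by (simp add: power2_eq_square)
  qed auto
  define B where "B = 4 * (z / 15 + 2)"
  note L = L[folded B_def] and lnM = lnM[folded B_def]
  define S where "S = sqrt (real M) * (ln (real M) / 2)"
  define R where "R = 116 / 100 * z\<^sup>2 * ((B + 1 / 3) / 2)"
  have "S \<le> R"
    unfolding S_def R_def using \<open>sqrt (real M) \<le> _\<close> lnM n by (intro mult_mono) auto
  moreover have "L\<^sup>2 \<le> B\<^sup>2" using L L0 by (intro power_mono) auto
  ultimately have "8 / 10 * (2 / 15 * z ^ 4 - 2 / 3) - 1 - 5 * (1 + (B + 1 / 3))
      \<le> 32 / 10 * B\<^sup>2 + 5 * B + 4 + R"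
    using main[folded S_def] L lnM unfolding z4 by argo
  moreover have "R = 116 / 100 * (2 / 15 * z ^ 3 + 25 / 6 * z\<^sup>2)"
    by (simp add: R_def B_def field_simps power2_eq_square power3_eq_cube)
  moreover have "B\<^sup>2 = 16 * (z\<^sup>2 / 225 + 4 / 15 * z + 4)"
    by (simp add: B_def field_simps power2_eq_square)
  \<comment> \<open>These inequalities compare each power with the next, so the remaining
    contradiction is linear in the powers of \<open>z\<close>.\<close>
  moreover have "12 * z \<le> z\<^sup>2" "12 * z\<^sup>2 \<le> z ^ 3" "12 * z ^ 3 \<le> z ^ 4"
    using \<open>12 \<le> z\<close> by (simp_all add: power2_eq_square power3_eq_cube power4_eq_xxxx mult_right_mono)
  ultimately show False using \<open>12 \<le> z\<close> unfolding B_def by argo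
qed

section \<open>Primes in (n, 4n/3] for small n\<close>

text \<open>The smaller factor in a factorisation has square at most \<open>n\<close>, so it lies
  below \<open>s\<close> and, unless it is 1, was tested. The disjunct \<open>n < d * d\<close>
  skips needless divisors when one \<open>s\<close> serves several \<open>n\<close>.\<close>

lemma prime_by_trial_division:
  assumes "1 < n" "n < s * s" "list_all (\<lambda>d. n < d * d \<or> n mod d \<noteq> 0) [2..<s]"
  shows "prime (n::nat)"
  unfolding prime_nat_iff
proof (intro conjI allI impI)
  have no_factor: "a = 1" if "n = a * b" "a \<le> b" for a b
  proof (rule ccontr)
    assume "a \<noteq> 1"
    have "a * a \<le> n" using that by simp
    then have "a < s" using assms(2) mult_le_mono[of s a s a] by (meson leD leI le_trans)
    moreover have "2 \<le> a" using \<open>a \<noteq> 1\<close> that assms(1) by (cases a) auto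
    ultimately have "n < a * a \<or> n mod a \<noteq> 0" using assms(3) by (simp add: list_all_iff)
    with \<open>a * a \<le> n\<close> that(1) show False by simp
  qed
  fix d assume "d dvd n"
  then obtain e where e: "n = d * e" by (auto simp: dvd_def)
  show "d = 1 \<or> d = n"
  proof (cases "d \<le> e")
    case True
    then show ?thesis using no_factor e by blast
  next
    case False
    then show ?thesis using no_factor[of e d] e by (simp add: mult.commute)
  qed
qed (fact assms(1))

text \<open>The first prime \<open>p\<close> of the chain above \<open>n\<close> works: its
  predecessor \<open>q\<close> is at most \<open>n\<close>, so 3p is at most 4q and hence at most
  4n.\<close>

lemma prime_between_chain:
  fixes n q :: nat
  assumes "q \<le> n" "n < last (q # ps)" "list_all prime ps"
    and "successively (\<lambda>q p. 3 * p \<le> 4 * q) (q # ps)"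
  shows "\<exists>p. prime p \<and> n < p \<and> 3 * p \<le> 4 * n"
  using assms
proof (induction ps arbitrary: q)
  case (Cons p ps)
  show ?case
  proof (cases "n < p")
    case True
    then show ?thesis using Cons.prems by (intro exI[of _ p]) auto
  next
    case False
    then show ?thesis using Cons.prems by (intro Cons.IH[of p]) auto
  qed
qed simp

lemma prime_between_small:
  fixes n :: nat
  assumes "28 \<le> n" "n < 22817"
  shows "\<exists>p. prime p \<and> n < p \<and> 3 * p \<le> 4 * n"
proof (rule prime_between_chain)
  \<comment> \<open>The chain ends above 12^4 = 20736, where \<open>prime_between_large\<close>
    takes over. It is split so that 24, 74 and 152, whose squares just exceed the last prime of each
    piece, serve as trial division bounds.\<close>
  let ?ps1 = "[37, 47, 61, 79, 103, 137, 181, 241, 317, 421, 557] :: nat list"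
  let ?ps2 = "[739, 983, 1307, 1741, 2311, 3079, 4099, 5449] :: nat list"
  let ?ps3 = "[7253, 9661, 12853, 17137, 22817] :: nat list"
  have "list_all prime ?ps1"
    unfolding list.pred_inject(2)
    by (intro conjI list.pred_inject(1); rule prime_by_trial_division[where s = 24]; simp)
  moreover have "list_all prime ?ps2"
    unfolding list.pred_inject(2)
    by (intro conjI list.pred_inject(1); rule prime_by_trial_division[where s = 74]; simp)
  moreover have "list_all prime ?ps3"
    unfolding list.pred_inject(2)
    by (intro conjI list.pred_inject(1); rule prime_by_trial_division[where s = 152]; simp)
  ultimately show "list_all prime (?ps1 @ ?ps2 @ ?ps3)"
    unfolding list_all_append by blast
  show "n < last (28 # ?ps1 @ ?ps2 @ ?ps3)" using assms(2) by simp
  show "successively (\<lambda>q p. 3 * p \<le> 4 * q) (28 # ?ps1 @ ?ps2 @ ?ps3)" by simp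
qed (fact assms(1))

lemma prime_between:
  fixes n :: nat
  assumes "28 \<le> n"
  shows "\<exists>p. prime p \<and> n < p \<and> 3 * p \<le> 4 * n"
  using prime_between_small[OF assms] prime_between_large[of n] by fastforce

section \<open>The prime m near sqrt t and the constant 15/7\<close>

lemma prime_ge_sqrt:
  fixes t :: nat
  assumes "811 \<le> t"
  shows "\<exists>m. prime m \<and> t \<le> m * m \<and> 3 * real m \<le> 4 * sqrt (real t)"
proof -
  \<comment> \<open>The largest integer strictly below sqrt t: a prime above it is at least sqrt t,
    and 4n/3 stays below 4/3 sqrt t. It is at least 28 since 28^2 = 784 < 811.\<close>
  define n where "n = nat \<lceil>sqrt (real t)\<rceil> - 1"
  have "28 < sqrt (real t)" using assms by (intro real_less_rsqrt) auto
  then have n: "real n < sqrt (real t)" "sqrt (real t) \<le> real n + 1" "28 \<le> n"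
    unfolding n_def by linarith+
  obtain m where m: "prime m" "n < m" "3 * m \<le> 4 * n" using prime_between[OF n(3)] by blast
  have "sqrt (real t) \<le> real m" using n(2) m(2) by linarith
  then have "real t \<le> (real m)\<^sup>2" by (rule sqrt_le_D)
  then have "t \<le> m * m" unfolding power2_eq_square by (metis of_nat_le_iff of_nat_mult)
  moreover have "3 * real m \<le> 4 * real n" using m(3) by linarith
  ultimately show ?thesis using m(1) n(1) by (intro exI[of _ m]) auto
qed

text \<open>Here \<open>x\<close> is sqrt t and \<open>s\<close> the block size. The left side is at
  most n m^2 / (m - k), hence at most n m^2 / (m - x/2). This is convex in m, with values 2xn at m =
  x and (32/15)xn at m = 4x/3, and 32/15 < 15/7. The product
  \<open>(m - x) * (4 * x - 3 * m)\<close> encodes the convexity argument.\<close>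

lemma block_count_bound:
  fixes x m n k s :: real
  assumes "0 < x" "x \<le> m" "3 * m \<le> 4 * x" "0 \<le> k" "2 * k \<le> x" "0 < n"
    and "(m - k) * (s - 1) \<le> n"
  shows "m * (n + k * (s - 1)) < 15 / 7 * x * n"
proof -
  have "k < m" using assms by linarith
  have "0 \<le> (m - x) * (4 * x - 3 * m)" using assms by (intro mult_nonneg_nonneg) auto
  moreover have "3 * m * x \<le> 4 * x * x" using assms by (intro mult_right_mono) auto
  moreover have "0 < x * x" using assms by simp
  moreover have "15 * x * (m - x / 2) \<le> 15 * x * (m - k)" using assms by (intro mult_left_mono) auto
  ultimately have key: "7 * (m * m) < 15 * x * (m - k)"
    by (simp add: algebra_simps)
  have "(m - k) * (n + k * (s - 1)) = (m - k) * n + k * ((m - k) * (s - 1))"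
    by (simp add: algebra_simps)
  also have "\<dots> \<le> (m - k) * n + k * n" using assms by (intro add_mono mult_left_mono) auto
  finally have "(m - k) * (n + k * (s - 1)) \<le> m * n" by (simp add: algebra_simps)
  then have "m * ((m - k) * (n + k * (s - 1))) \<le> m * (m * n)"
    using assms by (intro mult_left_mono) auto
  moreover have "7 * (m * m) * n < 15 * x * (m - k) * n"
    using key assms by (intro mult_strict_right_mono) auto
  ultimately have "(m - k) * (7 * (m * (n + k * (s - 1)))) < (m - k) * (15 * x * n)"
    by (simp add: algebra_simps)
  then have "7 * (m * (n + k * (s - 1))) < 15 * x * n" using \<open>k < m\<close> by simp
  then show ?thesis by simp
qed
section \<open>Universal graphs from lines in a finite plane\<close>

text \<open>Blocks are runs of \<open>s\<close> consecutive numbers. Each colour class starts a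
  fresh block, so only its last block can be partly empty, which wastes at most \<open>s - 1\<close>
  numbers per colour.\<close>

lemma blockwise_monochromatic_numbering:
  fixes c :: "'a \<Rightarrow> nat"
  assumes "finite V" "c ` V \<subseteq> {0..<k}" "0 < s"
  shows "\<exists>g M. inj_on g V \<and> (\<forall>v\<in>V. g v < s * M) \<and> s * M \<le> card V + k * (s - 1)
    \<and> (\<forall>u\<in>V. \<forall>v\<in>V. g u div s = g v div s \<longrightarrow> c u = c v)"
  using assms(1,2)
proof (induction k arbitrary: V)
  case 0
  then show ?case by (intro exI[of _ "\<lambda>_. 0"] exI[of _ 0]) auto
next
  case (Suc k)
  define W where "W = {v \<in> V. c v < k}"
  define X where "X = {v \<in> V. c v = k}"
  have V: "V = W \<union> X" "W \<inter> X = {}" and [simp]: "finite W" "finite X"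
    using Suc.prems by (auto simp: W_def X_def less_Suc_eq)
  have cW: "c ` W \<subseteq> {0..<k}" by (auto simp: W_def)
  have cX: "c v = k" if "v \<in> X" for v
    using that by (simp add: X_def)
  obtain g M where g: "inj_on g W" "\<forall>v\<in>W. g v < s * M" "s * M \<le> card W + k * (s - 1)"
      "\<forall>u\<in>W. \<forall>v\<in>W. g u div s = g v div s \<longrightarrow> c u = c v"
    using Suc.IH[OF \<open>finite W\<close> cW] by blast
  obtain r where r: "bij_betw r X {0..<card X}"
    using ex_bij_betw_finite_nat[OF \<open>finite X\<close>] by blast
  \<comment> \<open>The number of blocks for the new colour: \<open>card X / s\<close> rounded
    up.\<close>
  define Q where "Q = (card X + (s - 1)) div s"
  define h where "h v = (if v \<in> X then s * M + r v else g v)" for v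
  have "s * Q \<le> card X + (s - 1)" unfolding Q_def by (rule times_div_less_eq_dividend)
  have "card X \<le> s * Q"
    using dividend_less_times_div[OF \<open>0 < s\<close>, of "card X + (s - 1)"] \<open>0 < s\<close>
    unfolding Q_def by linarith
  have rX: "r v < card X" if "v \<in> X" for v using r that by (auto simp: bij_betw_def)
  have hW: "h v = g v" "h v < s * M" if "v \<in> W" for v
    using that V(2) g(2) by (auto simp: h_def)
  have hX: "h v = s * M + r v" "h v < s * M + s * Q" if "v \<in> X" for v
    using that rX[OF that] \<open>card X \<le> s * Q\<close> by (auto simp: h_def)
  have blockW: "h v div s < M" if "v \<in> W" for v
    using hW(2)[OF that] by (intro less_mult_imp_div_less) (simp add: mult.commute)
  have blockX: "M \<le> h v div s" if "v \<in> X" for v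
    unfolding hX(1)[OF that] using \<open>0 < s\<close> by (simp add: less_eq_div_iff_mult_less_eq mult.commute)
  have "inj_on h V"
  proof (rule inj_onI)
    fix u v assume uv: "u \<in> V" "v \<in> V" "h u = h v"
    then consider "u \<in> W" "v \<in> W" | "u \<in> X" "v \<in> X"
      using V(1) blockW[of u] blockX[of u] blockW[of v] blockX[of v] by fastforce
    then show "u = v"
    proof cases
      case 1
      then show ?thesis using uv g(1) hW by (auto dest: inj_onD)
    next
      case 2
      then show ?thesis using uv r hX by (auto simp: bij_betw_def dest: inj_onD)
    qed
  qed
  moreover have "\<forall>v\<in>V. h v < s * (M + Q)"
    unfolding V(1) using hW(2) hX(2) by (auto simp: distrib_left intro: trans_less_add1)
  moreover have "s * (M + Q) \<le> card V + Suc k * (s - 1)"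
    using g(3) \<open>s * Q \<le> card X + (s - 1)\<close> V(2)
    unfolding V(1) by (simp add: distrib_left card_Un_disjoint)
  moreover have "\<forall>u\<in>V. \<forall>v\<in>V. h u div s = h v div s \<longrightarrow> c u = c v"
  proof (intro ballI impI)
    fix u v assume uv: "u \<in> V" "v \<in> V" "h u div s = h v div s"
    then consider "u \<in> W" "v \<in> W" | "u \<in> X" "v \<in> X"
      using V(1) blockW[of u] blockX[of u] blockW[of v] blockX[of v] by fastforce
    then show "c u = c v"
    proof cases
      case 1
      with uv have "g u div s = g v div s" by (simp add: hW(1))
      with 1 g(4) show ?thesis by blast
    qed (simp add: cX)
  qed
  ultimately show ?case by blast
qed

section \<open>Lines over the integers modulo m and the universal graph built from them\<close>

definition line :: "nat \<Rightarrow> nat \<Rightarrow> nat \<Rightarrow> nat" where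
  "line m l i = (l div m * i + l mod m) mod m"

lemma cong_int_less_eq:
  assumes "int m dvd int a - int b" "a < m" "b < m"
  shows "a = b"
proof -
  have "int a mod int m = int b mod int m" using assms(1) unfolding mod_eq_dvd_iff .
  then show ?thesis using assms(2,3) by simp
qed

text \<open>Subtracting the congruences at \<open>i\<close> and \<open>j\<close> shows that
  \<open>m\<close> divides (a - a')(i - j). As \<open>m\<close> is prime and \<open>i\<close>,
  \<open>j\<close> are distinct residues, the slopes agree, and then so do the intercepts.\<close>

lemma line_inj:
  assumes "prime m" "l < m * m" "l' < m * m" "i < m" "j < m" "i \<noteq> j"
    and "line m l i = line m l' i" "line m l j = line m l' j"
  shows "l = l'"
proof -
  define a b a' b' where "a = l div m" and "b = l mod m"
    and "a' = l' div m" and "b' = l' mod m"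
  note defs = a_def b_def a'_def b'_def
  have "0 < m" using assms prime_gt_0_nat by blast
  have lt: "a < m" "a' < m" "b < m" "b' < m"
    using assms \<open>0 < m\<close> by (simp_all add: defs less_mult_imp_div_less)
  have "int m dvd (int a * int x + int b) - (int a' * int x + int b')"
    if "line m l x = line m l' x" for x
  proof -
    have "int (a * x + b) mod int m = int (a' * x + b') mod int m"
      using arg_cong[OF that, of int] unfolding line_def defs zmod_int .
    then show ?thesis unfolding mod_eq_dvd_iff by simp
  qed
  note dvd = this
  have "int m dvd ((int a * int i + int b) - (int a' * int i + int b'))
      - ((int a * int j + int b) - (int a' * int j + int b'))"
    using dvd[OF assms(7)] dvd[OF assms(8)] by (rule dvd_diff)
  also have "\<dots> = (int a - int a') * (int i - int j)" by (simp add: algebra_simps)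
  finally have "int m dvd int a - int a' \<or> int m dvd int i - int j"
    using assms(1) by (simp add: prime_dvd_mult_iff)
  moreover have "\<not> int m dvd int i - int j"
    using cong_int_less_eq[OF _ assms(4,5)] assms(6) by blast
  ultimately have "a = a'"
    using cong_int_less_eq[OF _ lt(1,2)] by blast
  moreover have "b = b'"
    using cong_int_less_eq[OF _ lt(3,4)] dvd[OF assms(7)] \<open>a = a'\<close> by simp
  ultimately show ?thesis
    using div_mult_mod_eq[of l m] div_mult_mod_eq[of l' m] unfolding defs by metis
qed

text \<open>If an edge of \<open>H\<close> lands on two vertices of the image of \<open>G\<close>,
  its ends lie in different blocks, so the lines of \<open>G\<close> and \<open>H\<close> meet twice
  and \<open>G = H\<close>. Thus no foreign edge spoils inducedness. The condition
  \<open>M \<le> m\<close> makes distinct block numbers distinct residues.\<close>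

lemma induced_universal_lines:
  fixes F :: "graph set" and g :: "graph \<Rightarrow> nat \<Rightarrow> nat"
  assumes "prime m" "finite F" "card F \<le> m * m" "M \<le> m"
    and simple: "\<And>G. G \<in> F \<Longrightarrow> simple_graph G"
    and inj: "\<And>G. G \<in> F \<Longrightarrow> inj_on (g G) (verts G)"
    and less: "\<And>G v. G \<in> F \<Longrightarrow> v \<in> verts G \<Longrightarrow> g G v < s * M"
    and indep: "\<And>G u v. G \<in> F \<Longrightarrow> (u, v) \<in> edges G \<Longrightarrow> g G u div s \<noteq> g G v div s"
  shows "univ_num F \<le> m * (s * M)"
proof -
  have "0 < m" using assms prime_gt_0_nat by blast
  obtain ix where ix: "bij_betw ix F {0..<card F}"
    using ex_bij_betw_finite_nat[OF \<open>finite F\<close>] by blast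
  have ix_less: "ix G < m * m" if "G \<in> F" for G
    using bij_betwE[OF ix] that assms(3) by auto
  \<comment> \<open>The number in base \<open>m\<close> encodes the pair of \<open>g G v\<close> and
    the line value. The former fixes the block and the position inside it, so quotient and remainder
    by \<open>m\<close> recover all that is needed.\<close>
  define f where "f G v = m * g G v + line m (ix G) (g G v div s)" for G v
  have line_less: "line m l i < m" for l i using \<open>0 < m\<close> by (simp add: line_def)
  have f_div: "f G v div m = g G v" for G v
    using line_less \<open>0 < m\<close> by (simp add: f_def)
  have f_mod: "f G v mod m = line m (ix G) (g G v div s)" for G v
    using line_less by (simp add: f_def)
  have f_less: "f G v < m * (s * M)" if "G \<in> F" "v \<in> verts G" for G v
  proof -
    have "f G v < m * Suc (g G v)" using line_less by (simp add: f_def)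
    also have "\<dots> \<le> m * (s * M)" using less[OF that] by (intro mult_le_mono) auto
    finally show ?thesis .
  qed
  have edge: "u \<in> verts G" "v \<in> verts G" "(v, u) \<in> edges G" if "G \<in> F" "(u, v) \<in> edges G" for G u v
    using simple[OF that(1)] that(2) by (auto simp: simple_graph_def)
  define U :: graph where
    "U = ({0..<m * (s * M)}, {(f G u, f G v) | G u v. G \<in> F \<and> (u, v) \<in> edges G})"
  have vU: "verts U = {0..<m * (s * M)}" by (simp add: U_def verts_def)
  have eU: "(x, y) \<in> edges U \<longleftrightarrow> (\<exists>G\<in>F. \<exists>u v. (u, v) \<in> edges G \<and> x = f G u \<and> y = f G v)" for x y
    unfolding U_def edges_def[of "(_, _)"] by auto
  have "simple_graph U"
    unfolding simple_graph_def
  proof (intro conjI allI impI)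
    show "edges U \<subseteq> verts U \<times> verts U"
      using f_less edge by (auto simp: eU vU)
    show "(y, x) \<in> edges U" if "(x, y) \<in> edges U" for x y
      using that edge unfolding eU by blast
    show "(x, x) \<notin> edges U" for x
    proof
      assume "(x, x) \<in> edges U"
      then obtain G u v where "G \<in> F" "(u, v) \<in> edges G" "f G u = f G v" by (auto simp: eU)
      then show False using indep f_div by metis
    qed
  qed (simp add: vU)
  moreover have "induced_embeds G U" if G: "G \<in> F" for G
    unfolding induced_embeds_def
  proof (intro exI conjI ballI)
    show "inj_on (f G) (verts G)"
      using inj[OF G] f_div by (metis inj_on_def)
    show "f G ` verts G \<subseteq> verts U" using f_less[OF G] by (auto simp: vU)
    fix u v assume uv: "u \<in> verts G" "v \<in> verts G"
    show "(u, v) \<in> edges G \<longleftrightarrow> (f G u, f G v) \<in> edges U"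
    proof
      assume "(f G u, f G v) \<in> edges U"
      then obtain H u' v' where H: "H \<in> F" "(u', v') \<in> edges H" "f G u = f H u'" "f G v = f H v'"
        by (auto simp: eU)
      have g_eq: "g G u = g H u'" "g G v = g H v'" using H f_div by metis+
      have "ix G = ix H"
      proof (rule line_inj[OF \<open>prime m\<close> ix_less[OF G] ix_less[OF H(1)]])
        show "g G u div s < m" "g G v div s < m"
          using less[OF G uv(1)] less[OF G uv(2)] \<open>M \<le> m\<close>
          by (auto dest!: less_mult_imp_div_less[of _ M s, unfolded mult.commute[of M]])
        show "g G u div s \<noteq> g G v div s" using indep[OF H(1,2)] g_eq by simp
        show "line m (ix G) (g G u div s) = line m (ix H) (g G u div s)"
          "line m (ix G) (g G v div s) = line m (ix H) (g G v div s)"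
          using H(3,4) f_mod g_eq by metis+
      qed
      then have "G = H" using ix G H(1) by (auto simp: bij_betw_def dest: inj_onD)
      moreover have "u = u'" "v = v'"
        using inj[OF G] g_eq uv edge[OF H(1,2)] \<open>G = H\<close> by (auto dest: inj_onD)
      ultimately show "(u, v) \<in> edges G" using H by simp
    qed (use G in \<open>auto simp: eU\<close>)
  qed
  ultimately have "induced_universal U F" by (simp add: induced_universal_def)
  then show ?thesis unfolding univ_num_def by (intro Least_le exI[of _ U]) (simp add: vU)
qed

section \<open>Choice of the block size and the final count\<close>

theorem theorem6:
  fixes n k p t :: nat and F :: "graph set"
  assumes "int p * (int k ^ 2 - 1) \<le> int n"
    and "finite F" and "card F = t"
    and "\<forall>G\<in>F. simple_graph G \<and> card (verts G) = n \<and> colorable k G \<and> pathwidth_le p G"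
    and "t \<ge> max (4 * k ^ 2) 811"
  shows "real (univ_num F) < 15 / 7 * sqrt (real t) * real n"
proof -
  have "811 \<le> t" "4 * k\<^sup>2 \<le> t" using assms(5) by auto
  \<comment> \<open>The strict bound needs this. For n = 0 the only graph is the empty one,
    contradicting \<open>811 \<le> t\<close>.\<close>
  have "0 < n"
  proof (rule ccontr)
    assume "\<not> 0 < n"
    have "F \<subseteq> {({}, {})}"
    proof
      fix G assume "G \<in> F"
      with assms(4) \<open>\<not> 0 < n\<close> have "simple_graph G" "card (verts G) = 0" by auto
      then have "verts G = {}" "edges G = {}" by (auto simp: simple_graph_def)
      then show "G \<in> {({}, {})}" by (cases G) (simp add: verts_def edges_def)
    qed
    from card_mono[OF _ this] \<open>811 \<le> t\<close> assms(3) show False by simp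
  qed
  obtain m where m: "prime m" "t \<le> m * m" "3 * real m \<le> 4 * sqrt (real t)"
    using prime_ge_sqrt[OF \<open>811 \<le> t\<close>] by blast
  have sqrt_m: "sqrt (real t) \<le> real m"
    using m(2) by (intro real_le_lsqrt) (auto simp: power2_eq_square simp flip: of_nat_mult)
  have "(2 * real k)\<^sup>2 \<le> real t"
    using of_nat_mono[OF \<open>4 * k\<^sup>2 \<le> t\<close>, where 'a = real] by (simp add: power_mult_distrib)
  then have k: "2 * real k \<le> sqrt (real t)" by (rule real_le_rsqrt)
  have "0 < sqrt (real t)" using \<open>811 \<le> t\<close> by simp
  then have "k < m" using k sqrt_m by linarith
  \<comment> \<open>The least positive \<open>s\<close> with \<open>n - k < (m + 1 - k) * s\<close>.
    This forces fewer than \<open>m + 1\<close> full blocks into the at most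
    \<open>n + k * (s - 1)\<close> numbers used, so the block numbers fit into the field. If
    \<open>n < k\<close>, truncated subtraction gives \<open>s = 1\<close>.\<close>
  define s where "s = (n - k) div (m + 1 - k) + 1"
  have "0 < s" by (simp add: s_def)
  have fit: "n + k * (s - 1) < s * (m + 1)"
  proof -
    have "n - k < (m + 1 - k) * s"
      using dividend_less_times_div[of "m + 1 - k" "n - k"] \<open>k < m\<close> by (simp add: s_def)
    then have "n < (m + 1 - k) * s + k" by linarith
    also have "(m + 1 - k) * s + k + k * (s - 1) = ((m + 1 - k) + k) * s"
      using \<open>0 < s\<close> by (cases s) (simp_all add: algebra_simps)
    finally show ?thesis using \<open>k < m\<close> by (simp add: mult.commute)
  qed
  \<comment> \<open>The block count \<open>M\<close> may vary from graph to graph; \<open>h\<close>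
    bounds it uniformly, depending only on \<open>n\<close>, \<open>k\<close> and
    \<open>s\<close>.\<close>
  define h where "h = (n + k * (s - 1)) div s"
  have "h \<le> m"
    using fit \<open>0 < s\<close> div_less_iff_less_mult[of s "n + k * (s - 1)" "m + 1"]
    by (simp add: h_def mult.commute)
  have "\<forall>G\<in>F. \<exists>g. inj_on g (verts G) \<and> (\<forall>v\<in>verts G. g v < s * h)
      \<and> (\<forall>u v. (u, v) \<in> edges G \<longrightarrow> g u div s \<noteq> g v div s)"
  proof
    fix G assume "G \<in> F"
    with assms(4) have G: "simple_graph G" "card (verts G) = n" "colorable k G" by auto
    then obtain c where c: "c ` verts G \<subseteq> {0..<k}" "\<forall>(u, v)\<in>edges G. c u \<noteq> c v"
      by (auto simp: colorable_def)
    have "finite (verts G)" and e: "edges G \<subseteq> verts G \<times> verts G"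
      using G by (auto simp: simple_graph_def)
    from blockwise_monochromatic_numbering[OF this(1) c(1) \<open>0 < s\<close>] obtain g M
      where g: "inj_on g (verts G)" "\<forall>v\<in>verts G. g v < s * M" "s * M \<le> n + k * (s - 1)"
        "\<forall>u\<in>verts G. \<forall>v\<in>verts G. g u div s = g v div s \<longrightarrow> c u = c v"
      unfolding G(2) by blast
    have "M \<le> h"
      using g(3) \<open>0 < s\<close> by (simp add: h_def less_eq_div_iff_mult_less_eq mult.commute)
    then have "s * M \<le> s * h" by simp
    then have "\<forall>v\<in>verts G. g v < s * h" using g(2) by (meson less_le_trans)
    moreover have "g u div s \<noteq> g v div s" if "(u, v) \<in> edges G" for u v
      using g(4) c(2) e that by blast
    ultimately show "\<exists>g. inj_on g (verts G) \<and> (\<forall>v\<in>verts G. g v < s * h)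
        \<and> (\<forall>u v. (u, v) \<in> edges G \<longrightarrow> g u div s \<noteq> g v div s)"
      using g(1) by blast
  qed
  from bchoice[OF this] obtain g where g:
    "\<forall>G\<in>F. inj_on (g G) (verts G) \<and> (\<forall>v\<in>verts G. g G v < s * h)
      \<and> (\<forall>u v. (u, v) \<in> edges G \<longrightarrow> g G u div s \<noteq> g G v div s)" ..
  have "univ_num F \<le> m * (s * h)"
    using m assms(2-4) g \<open>h \<le> m\<close> by (intro induced_universal_lines[of m F h g s]) blast+
  also have "s * h \<le> n + k * (s - 1)" unfolding h_def by (rule times_div_less_eq_dividend)
  finally have "univ_num F \<le> m * (n + k * (s - 1))" by simp
  then have "real (univ_num F) \<le> real m * (real n + real k * (real s - 1))"
    using of_nat_mono[of "univ_num F" "m * (n + k * (s - 1))", where 'a = real] \<open>0 < s\<close>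
    by (simp add: of_nat_diff)
  also have "\<dots> < 15 / 7 * sqrt (real t) * real n"
  proof (rule block_count_bound)
    have "(m - k) * (s - 1) \<le> (m + 1 - k) * ((n - k) div (m + 1 - k))"
      unfolding s_def by (intro mult_le_mono) auto
    also have "\<dots> \<le> n - k" by (rule times_div_less_eq_dividend)
    finally have "(m - k) * (s - 1) \<le> n" by simp
    then show "(real m - real k) * (real s - 1) \<le> real n"
      using of_nat_mono[of "(m - k) * (s - 1)" n, where 'a = real] \<open>0 < s\<close> \<open>k < m\<close>
      by (simp add: of_nat_diff)
  qed (use m k sqrt_m \<open>0 < sqrt (real t)\<close> \<open>0 < n\<close> in auto)
  finally show ?thesis .
qed

end
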